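(* For every $n\ge 0$, the maps $\mathrm{code}:R_n\to C_n$ and $\mathrm{decode}:C_n\to R_n$ are mutually inverse: for all $\mathsf{c}\in C_n$ and all $r\in R_n$, $\mathrm{code}(\mathrm{decode}(\mathsf{c}))=\mathsf{c}$ and $\mathrm{decode}(\mathrm{code}(r))=r$.
   Context: A rook (vector) of size $n$ is a word $r=r_1\dots r_n$ over $\{0,1,\dots,n\}$ whose nonzero letters are pairwise distinct; $R_n$ is the set of rooks of size $n$. For a rook $r$ of size $n$, $\mathrm{code}(r)$ is the word over $\mathbb{Z}$ of length $n$ defined recursively: $\mathrm{code}(\varepsilon)=\varepsilon$ (empty word); if $n$ occurs in $r$, write uniquely $r=\underline{b}\,n\,\underline{e}$ and set $\mathrm{code}(r)=\mathrm{code}(\underline{b}\,\underline{e})\cdot(\ell(\underline{b})+1)$; otherwise write uniquely $r=\underline{b}\,0\,\underline{e}$ where $\underline{b}$ contains no $0$, and set $\mathrm{code}(r)=\mathrm{code}(\underline{b}\,\underline{e})\cdot(-\ell(\underline{b}))$ (here $\ell$ is word length and $\cdot$ appends a letter; the shortened word $\underline{b}\,\underline{e}$ is regarded as a rook of size $n-1$). For a word $\underline{w}$ over $\mathbb{Z}$ define $m(\varepsilon)=0$ and $m(\underline{w}d)=-d$ if $d\le 0$, $m(\underline{w})+1$ if $0<d\le m(\underline{w})+1$, and $m(\underline{w})$ if $d>m(\underline{w})+1$. The set $C_n$ of $R$-codes of size $n$ is defined recursively: $\varepsilon\in C_0$, and $\underline{w}d\in C_n$ iff $\underline{w}\in C_{n-1}$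 and $-m(\underline{w})\le d\le n$. For $\mathsf{c}=\mathsf{c}_1\dots\mathsf{c}_n\in C_n$, $\mathrm{decode}(\mathsf{c})$ is defined recursively: $\mathrm{decode}(\varepsilon)=\varepsilon$; with $r'=\mathrm{decode}(\mathsf{c}_1\dots\mathsf{c}_{n-1})$, if $\mathsf{c}_n>0$ insert the letter $n$ into $r'$ so that it occupies position $\mathsf{c}_n$, and if $\mathsf{c}_n\le 0$ insert a letter $0$ into $r'$ so that it occupies position $-\mathsf{c}_n+1$ (positions counted from $1$). *)

theory Defs imports Main "HOL-Library.FuncSet"
begin

definition rooks :: "nat \<Rightarrow> nat list set" where
  "rooks n = {r. length r = n \<and> set r \<subseteq> {0..n} \<and> distinct (filter (\<lambda>x. x \<noteq> 0) r)}"

text \<open>The size of a rook is its length. If \<open>x\<close> occurs in \<open>r\<close>, then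
  \<open>takeWhile (\<lambda>y. y \<noteq> x) r\<close> and \<open>tl (dropWhile (\<lambda>y. y \<noteq> x) r)\<close> are the words \<open>b\<close> and \<open>e\<close>
  with \<open>r = b @ x # e\<close> and \<open>x\<close> not in \<open>b\<close>. A rook of size \<open>n\<close> not containing \<open>n > 0\<close> contains
  \<open>0\<close>, so the value \<open>undefined\<close> is never reached from a rook.\<close>

function code :: "nat list \<Rightarrow> int list" where
  "code r =
    (let n = length r in
     if r = [] then []
     else if n \<in> set r then
       (let b = takeWhile (\<lambda>y. y \<noteq> n) r; e = tl (dropWhile (\<lambda>y. y \<noteq> n) r)
        in code (b @ e) @ [int (length b) + 1])
     else if 0 \<in> set r then
       (let b = takeWhile (\<lambda>y. y \<noteq> 0) r; e = tl (dropWhile (\<lambda>y. y \<noteq> 0) r)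
        in code (b @ e) @ [- int (length b)])
     else undefined)"
  by auto

lemma length_remove_first_less:
  assumes "x \<in> set r"
  shows "length (takeWhile (\<lambda>y. y \<noteq> x) r @ tl (dropWhile (\<lambda>y. y \<noteq> x) r)) < length r"
  using assms by (induction r) auto

termination code
  by (relation "measure length") (use length_remove_first_less in \<open>auto simp del: neq0_conv length_append\<close>)

declare code.simps [simp del]

text \<open>The functions on codes recurse on the last letter.\<close>

function code_m :: "int list \<Rightarrow> int" where
  "code_m [] = 0"
| "code_m (w @ [d]) = (if d \<le> 0 then - d else if d \<le> code_m w + 1 then code_m w + 1 else code_m w)"
  by (auto, metis rev_exhaust)
termination
  by (relation "measure length") auto

fun R_codes :: "nat \<Rightarrow> int list set" where
  "R_codes 0 = {[]}"
| "R_codes (Suc n) = {w @ [d] | w d. w \<in> R_codes n \<and> - code_m w \<le> d \<and> d \<le> int (Suc n)}"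

definition insert_at :: "nat \<Rightarrow> 'a \<Rightarrow> 'a list \<Rightarrow> 'a list" where
  "insert_at i x xs = take (i - 1) xs @ x # drop (i - 1) xs" \<comment> \<open>positions are counted from 1\<close>

function decode :: "int list \<Rightarrow> nat list" where
  "decode [] = []"
| "decode (c @ [d]) =
    (if d > 0 then insert_at (nat d) (length c + 1) (decode c)
     else insert_at (nat (- d + 1)) 0 (decode c))"
  by (auto, metis rev_exhaust)
termination
  by (relation "measure length") auto

end

theory Submission imports Defs
begin

text \<open>The value \<open>m(c)\<close> is the length of the longest zero-free prefix of \<open>decode(c)\<close>.
  Hence the bound \<open>- m(c) \<le> d\<close> in the definition of R-codes says exactly that a zero inserted
  by \<open>d \<le> 0\<close> becomes the first zero of the word, which is the one that \<open>code\<close> removes.\<close>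

text \<open>Nonzero letters occur once, so deleting \<open>Suc n\<close> leaves letters at most
  \<open>n\<close>; conversely \<open>Suc n\<close> is new to a rook of size
  \<open>n\<close>.\<close>

lemma rooks_insert_Suc:
  "b @ Suc n # e \<in> rooks (Suc n) \<longleftrightarrow> b @ e \<in> rooks n"
proof
  assume "b @ Suc n # e \<in> rooks (Suc n)"
  then show "b @ e \<in> rooks n"
    unfolding rooks_def by (fastforce simp: le_Suc_eq)
next
  assume "b @ e \<in> rooks n"
  then show "b @ Suc n # e \<in> rooks (Suc n)"
    unfolding rooks_def by fastforce
qed

text \<open>The bound stays \<open>Suc n\<close>: once a zero is deleted, the letter
  \<open>Suc n\<close> may still occur, so \<open>b @ e\<close> need not lie in
  \<open>rooks n\<close>.\<close>

lemma rooks_insert_0: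
  "b @ 0 # e \<in> rooks (Suc n) \<longleftrightarrow> length (b @ e) = n \<and> set (b @ e) \<subseteq> {0..Suc n}
     \<and> distinct (filter (\<lambda>x. x \<noteq> 0) (b @ e))"
  unfolding rooks_def by auto

text \<open>The two cases mirror the branches of \<open>code\<close>;
  \<open>0 \<notin> set b\<close> singles out the first zero.\<close>

lemma rooks_Suc_cases:
  assumes "r \<in> rooks (Suc n)"
  obtains (big) b e where "r = b @ Suc n # e" "b @ e \<in> rooks n"
  | (zero) b e where "r = b @ 0 # e" "0 \<notin> set b" "b @ e \<in> rooks n"
proof (cases "Suc n \<in> set r")
  case True
  then obtain b e where "r = b @ Suc n # e"
    by (meson split_list)
  with assms show ?thesis
    using that(1) rooks_insert_Suc by blast
next
  case False
  have "0 \<in> set r"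
  \<comment> \<open>Pigeonhole: without \<open>0\<close> and \<open>Suc n\<close>, the word would
    have \<open>Suc n\<close> distinct letters in \<open>{1..n}\<close>.\<close>
  proof (rule ccontr)
    assume no0: "0 \<notin> set r"
    then have "filter (\<lambda>x. x \<noteq> 0) r = r"
      by (metis (mono_tags, lifting) filter_True)
    with assms have "distinct r" "length r = Suc n" "set r \<subseteq> {0..Suc n}"
      unfolding rooks_def by auto
    moreover from this have "set r \<subseteq> {1..n}"
      using no0 False by (auto simp: le_Suc_eq Suc_le_eq intro!: gr0I)
    ultimately show False
      using card_mono[of "{1..n}" "set r"] distinct_card[of r] by simp
  qed
  then obtain b e where r: "r = b @ 0 # e" "0 \<notin> set b"
    by (meson split_list_first)
  have "b @ e \<in> rooks n"
    using assms False unfolding r rooks_insert_0 by (auto simp: rooks_def le_Suc_eq)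
  with r show ?thesis
    using that(2) by blast
qed

lemma code_insert_Suc:
  assumes "b @ e \<in> rooks n"
  shows "code (b @ Suc n # e) = code (b @ e) @ [int (length b) + 1]"
proof -
  have "Suc n \<notin> set b" "length (b @ e) = n"
    using assms unfolding rooks_def by auto
  then have "takeWhile (\<lambda>y. y \<noteq> Suc n) (b @ Suc n # e) = b"
    "dropWhile (\<lambda>y. y \<noteq> Suc n) (b @ Suc n # e) = Suc n # e"
    "length (b @ Suc n # e) = Suc n"
    by (auto simp: takeWhile_append dropWhile_append)
  then show ?thesis
    by (subst code.simps) (simp add: Let_def)
qed

text \<open>Letters of \<open>b @ e\<close> are at most \<open>n\<close>, so the branch of
  \<open>code\<close> for the largest letter is skipped, and the displayed zero is the first
  one.\<close>

lemma code_insert_0: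
  assumes "b @ e \<in> rooks n" and "0 \<notin> set b"
  shows "code (b @ 0 # e) = code (b @ e) @ [- int (length b)]"
proof -
  have "Suc n \<notin> set (b @ 0 # e)" "length (b @ 0 # e) = Suc n"
    using assms unfolding rooks_def by auto
  moreover have "takeWhile (\<lambda>y. y \<noteq> 0) (b @ 0 # e) = b"
    "dropWhile (\<lambda>y. y \<noteq> 0) (b @ 0 # e) = 0 # e"
    using assms(2) by (auto simp: takeWhile_append dropWhile_append)
  ultimately show ?thesis
    by (subst code.simps) (simp add: Let_def)
qed

lemma insert_at_append: "insert_at (Suc (length b)) x (b @ e) = b @ x # e"
  by (simp add: insert_at_def)

lemma length_R_codes: "c \<in> R_codes n \<Longrightarrow> length c = n"
  by (induction n arbitrary: c) auto

lemma length_takeWhile_less: "\<exists>x \<in> set xs. \<not> P x \<Longrightarrow> length (takeWhile P xs) < length xs"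
  by (induction xs) auto

text \<open>This matches the recursion of \<open>code_m\<close> for \<open>d > 0\<close>: with
  \<open>d = length b + 1\<close>, the test \<open>d \<le> m + 1\<close> reads
  \<open>length b \<le> m\<close>.\<close>

lemma zero_free_prefix_length_insert:
  fixes b e :: "'a::zero list"
  assumes "x \<noteq> 0"
  defines "m \<equiv> length (takeWhile (\<lambda>y. y \<noteq> 0) (b @ e))"
  shows "length (takeWhile (\<lambda>y. y \<noteq> 0) (b @ x # e)) = (if length b \<le> m then Suc m else m)"
proof (cases "0 \<in> set b")
  case True
  then have "length (takeWhile (\<lambda>y. y \<noteq> 0) b) < length b"
    using length_takeWhile_less[of b "\<lambda>y. y \<noteq> 0"] by blast
  with True show ?thesis
    unfolding m_def by (auto simp: takeWhile_append)
next
  case False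
  with assms(1) show ?thesis
    unfolding m_def by (auto simp: takeWhile_append)
qed

text \<open>The claims are proved together: the value of \<open>code_m\<close> on the shorter code
  is what shows that an inserted zero comes first, and hence that \<open>code\<close> removes
  it.\<close>

lemma decode_R_codes:
  assumes "c \<in> R_codes n"
  shows "decode c \<in> rooks n \<and> code (decode c) = c
    \<and> code_m c = int (length (takeWhile (\<lambda>y. y \<noteq> 0) (decode c)))"
  using assms
proof (induction n arbitrary: c)
  case 0
  then show ?case
    by (simp add: rooks_def code.simps)
next
  case (Suc n)
  then obtain w d where c: "c = w @ [d]" and w: "w \<in> R_codes n"
    and d: "- code_m w \<le> d" "d \<le> int (Suc n)"
    by auto
  \<comment> \<open>\<open>k\<close> counts the letters before the inserted one, so its position is
    \<open>Suc k\<close> in both cases.\<close>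
  define k where "k = (if d > 0 then nat d - 1 else nat (- d))"
  define b where "b = take k (decode w)"
  define e where "e = drop k (decode w)"
  have be: "decode w = b @ e"
    by (simp add: b_def e_def)
  have rook: "b @ e \<in> rooks n" and code: "code (b @ e) = w"
    and m: "code_m w = int (length (takeWhile (\<lambda>y. y \<noteq> 0) (b @ e)))"
    using Suc.IH[OF w] be by auto
  have len: "length (decode w) = n"
    using rook be by (simp add: rooks_def)
  have m_le: "code_m w \<le> int n"
    using m len be length_takeWhile_le[of "\<lambda>y. y \<noteq> 0" "b @ e"] by simp
  \<comment> \<open>\<open>take\<close> is not cut short: \<open>k \<le> n\<close> follows from
    \<open>d \<le> Suc n\<close> if \<open>d > 0\<close>, and from
    \<open>- d \<le> code_m w \<le> n\<close> otherwise.\<close>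
  have lb: "length b = k"
    using d m_le len by (auto simp: b_def k_def)
  show ?case
  proof (cases "d > 0")
    case True
    then have dec: "decode c = b @ Suc n # e"
      using insert_at_append[of b "Suc n" e] lb length_R_codes[OF w] be
      by (simp add: c k_def Suc_nat_eq_nat_zadd1)
    moreover have "code_m c = int (length (takeWhile (\<lambda>y. y \<noteq> 0) (b @ Suc n # e)))"
      using True lb m unfolding zero_free_prefix_length_insert[OF nat.distinct(2)]
      by (auto simp: c k_def)
    ultimately show ?thesis
      using True rook code lb by (simp add: c k_def rooks_insert_Suc code_insert_Suc)
  next
    case False
    then have "nat (- d + 1) = Suc k"
      by (simp add: k_def)
    with False have dec: "decode c = b @ 0 # e"
      using insert_at_append[of b 0 e] lb be by (simp add: c)
    have le: "length b \<le> length (takeWhile (\<lambda>y. y \<noteq> 0) (b @ e))"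
      using d False m lb by (simp add: k_def)
    \<comment> \<open>A zero in \<open>b\<close> would end the zero-free prefix before length
      \<open>length b\<close>, against \<open>le\<close>.\<close>
    have b0: "0 \<notin> set b"
    proof
      assume "0 \<in> set b"
      then have "takeWhile (\<lambda>y. y \<noteq> 0) (b @ e) = takeWhile (\<lambda>y. y \<noteq> 0) b"
        by (auto simp: takeWhile_append)
      then show False
        using le length_takeWhile_less[of b "\<lambda>y. y \<noteq> 0"] \<open>0 \<in> set b\<close> by simp
    qed
    then have "takeWhile (\<lambda>y. y \<noteq> 0) (b @ 0 # e) = b"
      by (auto simp: takeWhile_append)
    moreover have "b @ 0 # e \<in> rooks (Suc n)"
      using rook unfolding rooks_insert_0 by (auto simp: rooks_def)
    ultimately show ?thesis
      using False code_insert_0[OF rook b0] code lb by (simp add: c[symmetric] dec) (simp add: c k_def)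
  qed
qed

lemma code_rooks:
  assumes "r \<in> rooks n"
  shows "code r \<in> R_codes n \<and> decode (code r) = r"
  using assms
proof (induction n arbitrary: r)
  case 0
  then show ?case
    by (simp add: rooks_def code.simps)
next
  case (Suc n)
  from Suc.prems show ?case
  proof (cases rule: rooks_Suc_cases)
    case (big b e)
    have IH: "code (b @ e) \<in> R_codes n" "decode (code (b @ e)) = b @ e"
      using Suc.IH[OF big(2)] by auto
    \<comment> \<open>As a prefix length, \<open>code_m\<close> is nonnegative, so the positive
      letter \<open>length b + 1\<close> meets the lower bound for R-codes.\<close>
    have "0 \<le> code_m (code (b @ e))"
      using decode_R_codes[OF IH(1)] by simp
    moreover have "length b \<le> n"
      using big(2) by (auto simp: rooks_def)
    ultimately show ?thesis
      using IH insert_at_append[of b "Suc n" e] length_R_codes[OF IH(1)]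
      by (simp add: big(1) code_insert_Suc[OF big(2)] nat_add_distrib)
  next
    case (zero b e)
    have IH: "code (b @ e) \<in> R_codes n" "decode (code (b @ e)) = b @ e"
      using Suc.IH[OF zero(3)] by auto
    have "takeWhile (\<lambda>y. y \<noteq> 0) (b @ e) = b @ takeWhile (\<lambda>y. y \<noteq> 0) e"
      using zero(2) by (auto simp: takeWhile_append)
    \<comment> \<open>The zero-free word \<open>b\<close> starts the prefix measured by
      \<open>code_m\<close>; this is the lower bound required of the letter
      \<open>- length b\<close>.\<close>
    then have "int (length b) \<le> code_m (code (b @ e))"
      using decode_R_codes[OF IH(1)] IH(2) by simp
    then show ?thesis
      using IH insert_at_append[of b 0 e]
      by (simp add: zero(1) code_insert_0[OF zero(3,2)] nat_add_distrib)
  qed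
qed

theorem theorem3p27:
  fixes n :: nat
  shows "code \<in> rooks n \<rightarrow> R_codes n \<and> decode \<in> R_codes n \<rightarrow> rooks n
    \<and> (\<forall>c \<in> R_codes n. code (decode c) = c) \<and> (\<forall>r \<in> rooks n. decode (code r) = r)"
  using decode_R_codes code_rooks by blast

end
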